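(* Let $n\in\mathbb{N}$ and let $I\subseteq[n]$, $\overline J\subseteq[\overline n]$ be nonempty. Then the $h$-vector of the $(I,\overline J)$-cyclohedral triangulation (the simplicial complex whose faces are the cyclic $(I,\overline J)$-forests) has entries $$h_k=\binom{|I|-1}{k}\binom{|\overline J|-1}{k}\quad\text{for all }k.$$
   Context: $[n]=\{0,\dots,n\}$, $[\overline n]=\{\overline 0,\dots,\overline n\}$. Differences are modulo $n+1$ with representatives in $\{0,\dots,n\}$. Arcs $(i,\overline j),(i',\overline{j'})\in I\times\overline J$ cyclically cross if either ($j-i'<j-i$ and $j-i'<j'-i'$) or ($j'-i<j-i$ and $j'-i<j'-i'$). A cyclic $(I,\overline J)$-forest is a set of arcs no two of which cyclically cross; maximal ones are cyclic $(I,\overline J)$-trees. The $(I,\overline J)$-cyclohedral triangulation is the triangulation of $\Delta_I\times\Delta_{\overline J}$ whose maximal simplices are $\operatorname{conv}\{(\mathbf e_i,\mathbf e_{\overline j}):(i,\overline j)\in T\}$ for cyclic $(I,\overline J)$-trees $T$. *)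

theory Defs
  imports Complex_Main
begin

text \<open>
  An arc from \<open>i\<close> to \<open>j\<close>-bar is the pair \<open>(i, j)\<close>: the second component stands for the barred
  copy of \<open>j\<close>, so the two copies of \<open>{0..n}\<close> are kept apart by position. In particular
  \<open>(i, i)\<close> is a legitimate arc.
\<close>

type_synonym arc = "nat \<times> nat"

definition cyc_diff :: "nat \<Rightarrow> nat \<Rightarrow> nat \<Rightarrow> int" where
  "cyc_diff n a b = (int a - int b) mod (int n + 1)"

text \<open>The two alternatives are not exclusive: two arcs may satisfy both.\<close>

fun cyc_cross :: "nat \<Rightarrow> arc \<Rightarrow> arc \<Rightarrow> bool" where
  "cyc_cross n (i, j) (i', j') \<longleftrightarrow>
     (cyc_diff n j i' < cyc_diff n j i \<and> cyc_diff n j i' < cyc_diff n j' i') \<or>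
     (cyc_diff n j' i < cyc_diff n j i \<and> cyc_diff n j' i < cyc_diff n j' i')"

definition cyclic_forest :: "nat \<Rightarrow> nat set \<Rightarrow> nat set \<Rightarrow> arc set \<Rightarrow> bool" where
  "cyclic_forest n I J F \<longleftrightarrow>
     F \<subseteq> I \<times> J \<and> (\<forall>\<alpha>\<in>F. \<forall>\<beta>\<in>F. \<alpha> \<noteq> \<beta> \<longrightarrow> \<not> cyc_cross n \<alpha> \<beta>)"

definition cyclic_tree :: "nat \<Rightarrow> nat set \<Rightarrow> nat set \<Rightarrow> arc set \<Rightarrow> bool" where
  "cyclic_tree n I J T \<longleftrightarrow>
     cyclic_forest n I J T \<and> (\<forall>F. cyclic_forest n I J F \<and> T \<subseteq> F \<longrightarrow> F = T)"

text \<open>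
  The triangulation as an abstract simplicial complex: the arc \<open>(i, j)\<close> is the vertex
  \<open>(e_i, e_j)\<close> of the product of simplices, and the empty forest is the empty face.
\<close>

definition cyclohedral_triangulation :: "nat \<Rightarrow> nat set \<Rightarrow> nat set \<Rightarrow> arc set set" where
  "cyclohedral_triangulation n I J = {F. cyclic_forest n I J F}"

lemma cyclohedral_triangulation_facets:
  assumes "finite I" and "finite J"
  shows "cyclohedral_triangulation n I J = {F. \<exists>T. cyclic_tree n I J T \<and> F \<subseteq> T}"
proof (intro set_eqI iffI)
  fix F assume "F \<in> cyclohedral_triangulation n I J"
  then have F: "F \<in> {F. cyclic_forest n I J F}"
    by (simp add: cyclohedral_triangulation_def)
  have "{F. cyclic_forest n I J F} \<subseteq> Pow (I \<times> J)"
    by (auto simp: cyclic_forest_def)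
  then have "finite {F. cyclic_forest n I J F}"
    using assms by (simp add: finite_subset)
  then obtain T where "cyclic_forest n I J T" "F \<subseteq> T"
    "\<forall>G. cyclic_forest n I J G \<longrightarrow> T \<subseteq> G \<longrightarrow> T = G"
    using finite_has_maximal2[OF _ F] by auto
  then show "F \<in> {F. \<exists>T. cyclic_tree n I J T \<and> F \<subseteq> T}"
    unfolding cyclic_tree_def by blast
next
  fix F assume "F \<in> {F. \<exists>T. cyclic_tree n I J T \<and> F \<subseteq> T}"
  then show "F \<in> cyclohedral_triangulation n I J"
    unfolding cyclohedral_triangulation_def cyclic_tree_def cyclic_forest_def by blast
qed

text \<open>
  For a finite abstract simplicial complex \<open>K\<close> (a family of faces containing the empty set),
  \<open>face_number K i\<close> counts the faces with \<open>i\<close> vertices, that is, it is the entry of the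
  \<open>f\<close>-vector usually indexed by the dimension \<open>i - 1\<close>, and \<open>complex_rank K\<close> is one more than the
  dimension of \<open>K\<close>. With \<open>d = complex_rank K\<close>, the \<open>h\<close>-vector is the one determined by
  \<open>(\<Sum>i\<le>d. face_number K i * (x - 1)^(d - i)) = (\<Sum>k\<le>d. h_vector K k * x^(d - k))\<close>,
  and all entries beyond \<open>d\<close> are zero.
\<close>

definition face_number :: "'a set set \<Rightarrow> nat \<Rightarrow> nat" where
  "face_number K i = card {F \<in> K. card F = i}"

definition complex_rank :: "'a set set \<Rightarrow> nat" where
  "complex_rank K = Max (card ` K)"

definition h_vector :: "'a set set \<Rightarrow> nat \<Rightarrow> int" where
  "h_vector K k =
     (\<Sum>i\<le>k. (- 1) ^ (k - i) * int ((complex_rank K - i) choose (k - i)) * int (face_number K i))"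

end

theory Submission
  imports Defs "HOL-Library.FuncSet" "HOL-Library.Multiset"
begin

text \<open>
  A monomial supported on a face, of degree \<open>m\<close>, is a multiset \<open>M\<close> of \<open>m\<close> arcs no two of which
  cross. It is determined by the multisets of its sources and of its targets, and these can be
  prescribed arbitrarily: an available arc of minimal cyclic length must occur in \<open>M\<close> (otherwise it
  would witness a crossing) and crosses no other available arc, so it can be split off. Hence there
  are \<open>(m + p choose m) * (m + q choose m)\<close> such monomials, where \<open>p = |I| - 1\<close> and \<open>q = |J| - 1\<close>.
  Counting them by support expresses these numbers through the face numbers by a unitriangular
  system, whose solution is found by two applications of Vandermonde's identity.
\<close>

section \<open>Binomial identities\<close>

lemma sum_triangle_swap:
  fixes a :: "nat \<Rightarrow> nat \<Rightarrow> 'a::comm_monoid_add"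
  shows "(\<Sum>k\<le>m. \<Sum>l\<le>k. a k l) = (\<Sum>l\<le>m. \<Sum>k=l..m. a k l)"
  unfolding sum.Sigma[OF finite_atMost ballI[OF finite_atMost]]
    sum.Sigma[OF finite_atMost ballI[OF finite_atLeastAtMost]]
  by (rule sum.reindex_bij_witness[of _ prod.swap prod.swap]) auto

lemma sum_atLeastAtMost_shift_atMost:
  fixes g :: "nat \<Rightarrow> 'a::comm_monoid_add"
  assumes "k \<le> m"
  shows "(\<Sum>i=k..m. g i) = (\<Sum>i\<le>m - k. g (i + k))"
  by (rule sum.reindex_bij_witness[of _ "\<lambda>i. i + k" "\<lambda>i. i - k"]) (use assms in auto)

lemma vandermonde_shifted:
  assumes "k \<le> m"
  shows "(\<Sum>i=k..m. (a choose (i - k)) * (b choose (m - i))) = (a + b) choose (m - k)"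
proof -
  have "(\<Sum>i=k..m. (a choose (i - k)) * (b choose (m - i))) =
        (\<Sum>i\<le>m - k. (a choose i) * (b choose (m - k - i)))"
    using assms by (simp add: sum_atLeastAtMost_shift_atMost add.commute)
  also have "\<dots> = (a + b) choose (m - k)"
    by (rule vandermonde)
  finally show ?thesis .
qed

text \<open>Both sides count flags of an \<open>l\<close>-subset inside a \<open>k\<close>-subset of
  a \<open>p\<close>-set. For \<open>k > p\<close> both vanish, so \<open>k\<close> may run past
  \<open>p\<close> in the sums below.\<close>

lemma choose_mult_choose:
  assumes "l \<le> k"
  shows "(p choose k) * (k choose l) = (p choose l) * ((p - l) choose (k - l))"
proof (cases "k \<le> p")
  case True
  then show ?thesis
    using assms by (simp add: choose_mult)
next
  case False
  then show ?thesis
    using assms by (cases "l \<le> p") (simp_all add: binomial_eq_0)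
qed

text \<open>Comparison of coefficients of \<open>x^m\<close> in the Hilbert series with numerator
  \<Sum>\<open>(p choose l) (q choose l) x^l\<close> and denominator
  \<open>(1 - x)^(p + q + 1)\<close>. The proof expands \<open>(m + p) choose m\<close> over
  \<open>k\<close>, splits each term over \<open>l\<close>, and then sums over \<open>k\<close>
  first.\<close>

lemma sum_choose_choose_mult_choose:
  "(\<Sum>l\<le>m. (p choose l) * (q choose l) * ((p + q + m - l) choose (m - l))) =
   ((m + p) choose m) * ((m + q) choose m)"
proof -
  have summand: "((p choose k) * (m choose (m - k))) * ((m + q) choose m) =
      (\<Sum>l\<le>k. ((p choose l) * (q choose l)) * (((p - l) choose (k - l)) * ((m + q) choose (m - k))))"
    if "k \<le> m" for k
  proof -
    \<comment> \<open>Trinomial revision leaves \<open>(q + k) choose k\<close>, which Vandermonde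
      splits over \<open>l\<close>.\<close>
    have "((m + q) choose m) * (m choose (m - k)) = ((m + q) choose (m - k)) * ((q + k) choose k)"
      using that choose_mult[of "m - k" m "m + q"] by (simp add: algebra_simps)
    also have "(q + k) choose k = (\<Sum>l\<le>k. (q choose l) * (k choose l))"
      unfolding vandermonde[symmetric]
      by (intro sum.cong refl) (simp add: binomial_symmetric[symmetric])
    finally have "((p choose k) * (m choose (m - k))) * ((m + q) choose m) =
        (\<Sum>l\<le>k. ((p choose k) * (k choose l)) * (q choose l) * ((m + q) choose (m - k)))"
      by (simp add: sum_distrib_left sum_distrib_right mult_ac)
    also have "\<dots> = (\<Sum>l\<le>k. ((p choose l) * (q choose l)) *
        (((p - l) choose (k - l)) * ((m + q) choose (m - k))))"
      by (intro sum.cong refl) (simp add: choose_mult_choose)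
    finally show ?thesis .
  qed
  have "((m + p) choose m) * ((m + q) choose m) =
        (\<Sum>k\<le>m. ((p choose k) * (m choose (m - k))) * ((m + q) choose m))"
    by (simp add: vandermonde add.commute flip: sum_distrib_right)
  also have "\<dots> = (\<Sum>k\<le>m. \<Sum>l\<le>k. ((p choose l) * (q choose l)) *
      (((p - l) choose (k - l)) * ((m + q) choose (m - k))))"
    by (intro sum.cong refl summand) simp
  also have "\<dots> = (\<Sum>l\<le>m. ((p choose l) * (q choose l)) *
      (\<Sum>k=l..m. ((p - l) choose (k - l)) * ((m + q) choose (m - k))))"
    unfolding sum_triangle_swap sum_distrib_left ..
  also have "\<dots> = (\<Sum>l\<le>m. ((p choose l) * (q choose l)) * ((p - l + (m + q)) choose (m - l)))"
    by (intro sum.cong refl) (simp add: vandermonde_shifted)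
  also have "\<dots> = (\<Sum>l\<le>m. (p choose l) * (q choose l) * ((p + q + m - l) choose (m - l)))"
  \<comment> \<open>The upper indices agree only for \<open>l \<le> p\<close>, because subtraction
    is truncated; for \<open>l > p\<close> the factor \<open>p choose l\<close> is zero.\<close>
  proof (intro sum.cong refl)
    fix l
    show "((p choose l) * (q choose l)) * ((p - l + (m + q)) choose (m - l)) =
          (p choose l) * (q choose l) * ((p + q + m - l) choose (m - l))"
      by (cases "l \<le> p") (auto simp: add_ac)
  qed
  finally show ?thesis ..
qed

text \<open>Replacing \<open>i\<close> by \<open>k - i\<close> gives the expansion of
  \<open>(1 - 1)^(k - l)\<close>. This orthogonality inverts the passage from \<open>h\<close> to
  face numbers.\<close>

lemma sum_alternating_choose_shifted:
  assumes "l \<le> k"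
  shows "(\<Sum>i=l..k. (- 1) ^ (k - i) * int ((k - l) choose (i - l))) = (if l = k then 1 else 0)"
proof -
  have "(\<Sum>i=l..k. (- 1) ^ (k - i) * int ((k - l) choose (i - l))) =
        (\<Sum>i\<le>k - l. (- 1) ^ i * int ((k - l) choose i))"
  proof (rule sum.reindex_bij_witness[of _ "\<lambda>i. k - i" "\<lambda>i. k - i"])
    fix i assume i: "i \<in> {l..k}"
    then have "(k - l) choose (i - l) = (k - l) choose (k - l - (i - l))"
      by (intro binomial_symmetric) auto
    also have "k - l - (i - l) = k - i"
      using i by auto
    finally show "(- 1) ^ (k - i) * int ((k - l) choose (k - i)) =
        (- 1) ^ (k - i) * int ((k - l) choose (i - l))"
      by simp
  qed (use assms in auto)
  then show ?thesis
    using assms choose_alternating_sum[of "k - l", where ?'a = int] by auto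
qed

section \<open>Face numbers and the h-vector\<close>

text \<open>Since \<open>d - k\<close> is truncated, the vanishing of \<open>h\<close> beyond \<open>d\<close> has to be assumed.\<close>

lemma h_vector_eqI:
  fixes h :: "nat \<Rightarrow> nat"
  assumes "finite K"
    and face: "\<And>i. face_number K i = (\<Sum>k\<le>i. h k * ((d - k) choose (i - k)))"
    and beyond: "\<And>k. d < k \<Longrightarrow> h k = 0"
    and "h 0 > 0"
  shows "h_vector K k = int (h k)"
proof -
  have face0: "face_number K i = 0" if "d < i" for i
    unfolding face
  proof (intro sum.neutral ballI)
    fix k assume "k \<in> {..i}"
    then show "h k * ((d - k) choose (i - k)) = 0"
      using that beyond by (cases "k \<le> d") auto
  qed
  \<comment> \<open>The term \<open>k = 0\<close> contributes \<open>h 0 > 0\<close>, so a face with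
    \<open>d\<close> vertices exists; with \<open>face0\<close> this fixes the rank as
    \<open>d\<close>.\<close>
  have "face_number K d \<ge> h 0 * ((d - 0) choose (d - 0))"
    unfolding face by (rule member_le_sum) auto
  then have "{F \<in> K. card F = d} \<noteq> {}"
    using \<open>h 0 > 0\<close> by (auto simp: face_number_def simp del: Collect_empty_eq)
  then have "d \<in> card ` K"
    by auto
  moreover have "card F \<le> d" if "F \<in> K" for F
  proof (rule ccontr)
    assume "\<not> card F \<le> d"
    then have "{G \<in> K. card G = card F} = {}"
      using face0[of "card F"] \<open>finite K\<close> by (simp add: face_number_def)
    then show False
      using that by auto
  qed
  ultimately have rank: "complex_rank K = d"
    unfolding complex_rank_def using \<open>finite K\<close> by (intro Max_eqI) auto
  show ?thesis
  proof (cases "k \<le> d")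
    case True
    \<comment> \<open>Trinomial revision isolates the dependence on \<open>i\<close> in the
      alternating factor, so that orthogonality applies once the sums are swapped.\<close>
    have summand: "(- 1) ^ (k - i) * int ((d - i) choose (k - i)) * int (face_number K i) =
        (\<Sum>l\<le>i. (int (h l) * int ((d - l) choose (k - l))) *
          ((- 1) ^ (k - i) * int ((k - l) choose (i - l))))" if "i \<le> k" for i
    proof -
      have "((d - i) choose (k - i)) * face_number K i =
          (\<Sum>l\<le>i. h l * (((d - l) choose (i - l)) * ((d - i) choose (k - i))))"
        by (simp add: face sum_distrib_left mult_ac)
      also have "\<dots> = (\<Sum>l\<le>i. h l * (((d - l) choose (k - l)) * ((k - l) choose (i - l))))"
        using that True choose_mult[of "i - l" "k - l" "d - l" for l]
        by (intro sum.cong refl) (simp add: diff_diff_eq)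
      finally have "int ((d - i) choose (k - i)) * int (face_number K i) =
          (\<Sum>l\<le>i. int (h l) * (int ((d - l) choose (k - l)) * int ((k - l) choose (i - l))))"
        by (simp flip: of_nat_mult of_nat_sum)
      then show ?thesis
        by (simp add: mult.assoc sum_distrib_left mult.left_commute)
    qed
    have "h_vector K k = (\<Sum>i\<le>k. \<Sum>l\<le>i. (int (h l) * int ((d - l) choose (k - l))) *
        ((- 1) ^ (k - i) * int ((k - l) choose (i - l))))"
      unfolding h_vector_def rank by (intro sum.cong refl summand) simp
    also have "\<dots> = (\<Sum>l\<le>k. (int (h l) * int ((d - l) choose (k - l))) *
        (\<Sum>i=l..k. (- 1) ^ (k - i) * int ((k - l) choose (i - l))))"
      unfolding sum_triangle_swap sum_distrib_left ..
    also have "\<dots> = (\<Sum>l\<le>k. (int (h l) * int ((d - l) choose (k - l))) * (if l = k then 1 else 0))"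
      by (intro sum.cong refl) (simp add: sum_alternating_choose_shifted)
    also have "\<dots> = int (h k)"
      by (simp add: if_distrib cong: if_cong)
    finally show ?thesis .
  next
    case False
    \<comment> \<open>For \<open>i \<le> d\<close> the binomial is zero since
      \<open>d - i < k - i\<close>; for \<open>i > d\<close> the face number is zero.\<close>
    have "(- 1) ^ (k - i) * int ((d - i) choose (k - i)) * int (face_number K i) = 0" for i
      using False face0[of i] by (cases "i \<le> d") auto
    then show ?thesis
      using False beyond[of k] by (simp only: h_vector_def rank sum.neutral_const of_nat_0)
  qed
qed

section \<open>Counting multisets by their support\<close>

text \<open>Removing one copy of each element of \<open>F\<close> leaves an arbitrary multiset over
  \<open>F\<close> of size \<open>m - card F\<close>. The truncated \<open>m - 1\<close> also gives
  the right value 1 for \<open>m = 0\<close> and \<open>F\<close> empty.\<close>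

lemma card_multisets_with_support:
  assumes "finite F"
  shows "card {M. set_mset M = F \<and> size M = m} =
    (if card F \<le> m then (m - 1) choose (m - card F) else 0)"
proof (cases "card F \<le> m")
  case True
  have "bij_betw (\<lambda>M. M + mset_set F) (multisets_of_size F (m - card F))
      {M. set_mset M = F \<and> size M = m}"
  proof (rule bij_betwI[where g = "\<lambda>M. M - mset_set F"])
    show "(\<lambda>M. M + mset_set F) \<in>
        multisets_of_size F (m - card F) \<rightarrow> {M. set_mset M = F \<and> size M = m}"
      using True assms by (auto simp: multisets_of_size_def)
    have sub: "mset_set F \<subseteq># M" if "set_mset M = F" for M
      using that mset_set_set_mset_msubset by blast
    show "(\<lambda>M. M - mset_set F) \<in>
        {M. set_mset M = F \<and> size M = m} \<rightarrow> multisets_of_size F (m - card F)"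
      using sub by (auto simp: multisets_of_size_def size_Diff_submset dest: in_diffD)
    show "M - mset_set F + mset_set F = M" if "M \<in> {M. set_mset M = F \<and> size M = m}" for M
      using that sub by simp
  qed simp
  then have "card {M. set_mset M = F \<and> size M = m} = card (multisets_of_size F (m - card F))"
    by (rule bij_betw_same_card[symmetric])
  then show ?thesis
    using True assms by (simp add: card_multisets_of_size)
next
  case False
  have "card F \<le> m" if "set_mset M = F" "size M = m" for M
    using that size_mset_mono[OF mset_set_set_mset_msubset[of M]] by simp
  then have "{M. set_mset M = F \<and> size M = m} = {}"
    using False by auto
  then show ?thesis
    using False by (simp only: card.empty if_False)
qed

text \<open>This is the Hilbert function of the Stanley-Reisner ring of \<open>K\<close>: multisets
  are grouped by support, and supports by cardinality.\<close>

lemma card_multisets_supported_on_faces: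
  assumes "finite K" and fin: "\<And>F. F \<in> K \<Longrightarrow> finite F"
  shows "card {M. set_mset M \<in> K \<and> size M = m} =
    (\<Sum>i\<le>m. face_number K i * ((m - 1) choose (m - i)))"
proof -
  let ?S = "\<lambda>F. {M. set_mset M = F \<and> size M = m}"
  have "{M. set_mset M \<in> K \<and> size M = m} = (\<Union>F\<in>K. ?S F)"
    by auto
  moreover have "finite (?S F)" if "F \<in> K" for F
    by (rule finite_subset[OF _ finite_multisets_of_size[OF fin[OF that], of m]])
       (auto simp: multisets_of_size_def)
  ultimately have "card {M. set_mset M \<in> K \<and> size M = m} = (\<Sum>F\<in>K. card (?S F))"
    using \<open>finite K\<close> by (simp only:) (intro card_UN_disjoint, auto)
  also have "\<dots> = (\<Sum>F\<in>K. if card F \<le> m then (m - 1) choose (m - card F) else 0)"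
    by (intro sum.cong refl card_multisets_with_support fin)
  also have "\<dots> = (\<Sum>F\<in>{F \<in> K. card F \<le> m}. (m - 1) choose (m - card F))"
    using \<open>finite K\<close> by (rule sum.inter_filter[symmetric])
  also have "\<dots> = (\<Sum>i\<le>m. \<Sum>F\<in>{F \<in> {F \<in> K. card F \<le> m}. card F = i}. (m - 1) choose (m - card F))"
    using \<open>finite K\<close> by (intro sum.group[symmetric]) auto
  also have "\<dots> = (\<Sum>i\<le>m. face_number K i * ((m - 1) choose (m - i)))"
  proof (intro sum.cong refl)
    fix i assume "i \<in> {..m}"
    then have "{F \<in> {F \<in> K. card F \<le> m}. card F = i} = {F \<in> K. card F = i}"
      by auto
    then show "(\<Sum>F\<in>{F \<in> {F \<in> K. card F \<le> m}. card F = i}. (m - 1) choose (m - card F)) =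
        face_number K i * ((m - 1) choose (m - i))"
      by (simp add: face_number_def)
  qed
  finally show ?thesis .
qed

text \<open>The diagonal coefficient \<open>(m - 1) choose 0\<close> is 1, even at
  \<open>m = 0\<close>, so strong induction cancels all earlier terms.\<close>

lemma unitriangular_choose_unique:
  fixes f g :: "nat \<Rightarrow> nat"
  assumes "\<And>m. (\<Sum>i\<le>m. f i * ((m - 1) choose (m - i))) = (\<Sum>i\<le>m. g i * ((m - 1) choose (m - i)))"
  shows "f m = g m"
proof (induction m rule: less_induct)
  case (less m)
  have "(\<Sum>i<m. f i * ((m - 1) choose (m - i))) = (\<Sum>i<m. g i * ((m - 1) choose (m - i)))"
    by (intro sum.cong refl) (simp add: less)
  then show ?case
    using assms[of m] by (simp flip: lessThan_Suc_atMost)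
qed

text \<open>The proposed face numbers solve the same unitriangular system as the true ones:
  Vandermonde over \<open>i\<close> reduces it to \<open>sum_choose_choose_mult_choose\<close>. The
  expected rank is \<open>p + q + 1\<close>.\<close>

lemma face_number_from_multiset_count:
  assumes "finite K" and "\<And>F. F \<in> K \<Longrightarrow> finite F"
    and count: "\<And>m. card {M. set_mset M \<in> K \<and> size M = m} =
      ((m + p) choose m) * ((m + q) choose m)"
  shows "face_number K i =
    (\<Sum>k\<le>i. ((p choose k) * (q choose k)) * ((p + q + 1 - k) choose (i - k)))"
proof (rule unitriangular_choose_unique[where f = "face_number K"])
  fix m
  have "(\<Sum>i\<le>m. (\<Sum>k\<le>i. ((p choose k) * (q choose k)) * ((p + q + 1 - k) choose (i - k))) *
      ((m - 1) choose (m - i))) =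
    (\<Sum>i\<le>m. \<Sum>k\<le>i. ((p choose k) * (q choose k)) *
      (((p + q + 1 - k) choose (i - k)) * ((m - 1) choose (m - i))))"
    by (simp add: sum_distrib_right mult.assoc)
  also have "\<dots> = (\<Sum>k\<le>m. ((p choose k) * (q choose k)) *
      (\<Sum>i=k..m. ((p + q + 1 - k) choose (i - k)) * ((m - 1) choose (m - i))))"
    unfolding sum_triangle_swap sum_distrib_left ..
  also have "\<dots> = (\<Sum>k\<le>m. (p choose k) * (q choose k) * ((p + q + m - k) choose (m - k)))"
  proof (intro sum.cong refl)
    fix k assume k: "k \<in> {..m}"
    \<comment> \<open>At \<open>m = 0\<close> the upper indices may differ, but both lower indices
      are 0. For \<open>k > p\<close> the prefactor vanishes.\<close>
    have "(p + q + 1 - k + (m - 1)) choose (m - k) = (p + q + m - k) choose (m - k)" if "k \<le> p"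
      using that k by (cases m) auto
    then show "((p choose k) * (q choose k)) *
        (\<Sum>i=k..m. ((p + q + 1 - k) choose (i - k)) * ((m - 1) choose (m - i))) =
        (p choose k) * (q choose k) * ((p + q + m - k) choose (m - k))"
      using k by (cases "k \<le> p") (simp_all add: vandermonde_shifted del: One_nat_def)
  qed
  also have "\<dots> = card {M. set_mset M \<in> K \<and> size M = m}"
    by (simp only: sum_choose_choose_mult_choose count)
  also have "\<dots> = (\<Sum>i\<le>m. face_number K i * ((m - 1) choose (m - i)))"
    using assms by (intro card_multisets_supported_on_faces)
  finally show "(\<Sum>i\<le>m. face_number K i * ((m - 1) choose (m - i))) =
    (\<Sum>i\<le>m. (\<Sum>k\<le>i. ((p choose k) * (q choose k)) * ((p + q + 1 - k) choose (i - k))) *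
      ((m - 1) choose (m - i)))" ..
qed

section \<open>Noncrossing multisets of arcs\<close>

lemma int_mod_eq_imp_eq:
  assumes "(a - c) mod (int n + 1) = (b - c) mod (int n + 1)"
    and "0 \<le> a" "a \<le> int n" "0 \<le> b" "b \<le> int n"
  shows "a = b"
proof -
  have "((a - c) + c) mod (int n + 1) = ((b - c) + c) mod (int n + 1)"
    using assms(1) by (rule mod_add_cong) simp
  then show ?thesis
    using assms(2-) by simp
qed

lemma cyc_diff_left_inj:
  assumes "cyc_diff n j i = cyc_diff n j' i" "j \<le> n" "j' \<le> n"
  shows "j = j'"
  using int_mod_eq_imp_eq[of "int j" "int i" n "int j'"] assms by (simp add: cyc_diff_def)

lemma cyc_diff_right_inj:
  assumes "cyc_diff n j i = cyc_diff n j i'" "i \<le> n" "i' \<le> n"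
  shows "i = i'"
proof -
  have "(- (int j - int i)) mod (int n + 1) = (- (int j - int i')) mod (int n + 1)"
    using assms(1) unfolding cyc_diff_def by (rule mod_minus_cong)
  then show ?thesis
    using int_mod_eq_imp_eq[of "int i" "int j" n "int i'"] assms(2-) by simp
qed

text \<open>If \<open>(i, j)\<close> were absent, \<open>M\<close> would contain arcs
  \<open>(i, j')\<close> and \<open>(i', j)\<close> with other endpoints. Injectivity of
  \<open>cyc_diff\<close> in each argument makes both strictly longer than \<open>(i, j)\<close>,
  which is the second alternative of a crossing.\<close>

lemma shortest_arc_in_noncrossing_mset:
  assumes forest: "cyclic_forest n I J (set_mset M)"
    and bounds: "I \<subseteq> {0..n}" "J \<subseteq> {0..n}"
    and i: "i \<in># image_mset fst M" and j: "j \<in># image_mset snd M"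
    and min: "\<And>i' j'. i' \<in># image_mset fst M \<Longrightarrow> j' \<in># image_mset snd M \<Longrightarrow>
      cyc_diff n j i \<le> cyc_diff n j' i'"
  shows "(i, j) \<in># M"
proof (rule ccontr)
  assume notin: "(i, j) \<notin># M"
  obtain j' where j': "(i, j') \<in># M"
    using i by force
  obtain i' where i': "(i', j) \<in># M"
    using j by force
  have ne: "i \<noteq> i'" "j \<noteq> j'"
    using notin i' j' by auto
  have le: "i \<le> n" "i' \<le> n" "j \<le> n" "j' \<le> n"
    using forest bounds i' j' by (auto simp: cyclic_forest_def)
  have "cyc_diff n j i \<le> cyc_diff n j' i" "cyc_diff n j i \<le> cyc_diff n j i'"
    using min imageI[OF i', of fst] imageI[OF i', of snd] imageI[OF j', of fst] imageI[OF j', of snd]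
    by auto
  then have "cyc_diff n j i < cyc_diff n j' i" "cyc_diff n j i < cyc_diff n j i'"
    using ne le cyc_diff_left_inj[of n j i j'] cyc_diff_right_inj[of n j i i'] by force+
  then have "cyc_cross n (i, j') (i', j)"
    by simp
  then show False
    using forest i' j' ne unfolding cyclic_forest_def by blast
qed

lemma obtain_shortest_arc:
  assumes "A \<noteq> {#}" "B \<noteq> {#}"
  obtains i j where "i \<in># A" "j \<in># B"
    "\<And>i' j'. i' \<in># A \<Longrightarrow> j' \<in># B \<Longrightarrow> cyc_diff n j i \<le> cyc_diff n j' i'"
proof -
  let ?f = "\<lambda>(i, j). cyc_diff n j i"
  have fin: "finite (set_mset A \<times> set_mset B)" and ne: "set_mset A \<times> set_mset B \<noteq> {}"
    using assms by auto
  obtain a where "is_arg_min ?f (\<lambda>a. a \<in> set_mset A \<times> set_mset B) a"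
    using ex_is_arg_min_if_finite[OF fin ne] by blast
  then show ?thesis
    by (intro that[of "fst a" "snd a"]) (auto simp: is_arg_min_linorder)
qed

lemma noncrossing_mset_unique:
  assumes "cyclic_forest n I J (set_mset M)" "cyclic_forest n I J (set_mset N)"
    and "image_mset fst M = image_mset fst N" "image_mset snd M = image_mset snd N"
    and "I \<subseteq> {0..n}" "J \<subseteq> {0..n}"
  shows "M = N"
  using assms
proof (induction "size M" arbitrary: M N)
  case 0
  then show ?case
    by auto
next
  case (Suc m)
  have "image_mset fst M \<noteq> {#}" "image_mset snd M \<noteq> {#}"
    using Suc.hyps by auto
  then obtain i j where ij: "i \<in># image_mset fst M" "j \<in># image_mset snd M"
    and min: "\<And>i' j'. i' \<in># image_mset fst M \<Longrightarrow> j' \<in># image_mset snd M \<Longrightarrow>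
      cyc_diff n j i \<le> cyc_diff n j' i'"
    using obtain_shortest_arc[where n = n] by blast
  have "(i, j) \<in># M"
    by (rule shortest_arc_in_noncrossing_mset[OF Suc.prems(1,5,6) ij min])
  then obtain M' where M': "M = add_mset (i, j) M'"
    by (rule mset_add)
  \<comment> \<open>Minimality refers only to the two projections, which \<open>N\<close> shares
    with \<open>M\<close>, so the same arc splits off from both.\<close>
  have "(i, j) \<in># N"
    by (rule shortest_arc_in_noncrossing_mset[OF Suc.prems(2,5,6) 
        ij[unfolded Suc.prems] min[unfolded Suc.prems]])
  then obtain N' where N': "N = add_mset (i, j) N'"
    by (rule mset_add)
  have "cyclic_forest n I J (set_mset M')" "cyclic_forest n I J (set_mset N')"
    using Suc.prems(1,2) by (auto simp: M' N' cyclic_forest_def)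
  then have "M' = N'"
    using Suc.hyps Suc.prems by (intro Suc.hyps(1)) (auto simp: M' N')
  then show ?case
    by (simp add: M' N')
qed

text \<open>Greedy matching: a shortest available arc is chosen and the remaining sources and
  targets are matched recursively.\<close>

lemma noncrossing_mset_exists:
  assumes "size A = size B" "set_mset A \<subseteq> I" "set_mset B \<subseteq> J"
  shows "\<exists>M. cyclic_forest n I J (set_mset M) \<and> image_mset fst M = A \<and> image_mset snd M = B"
  using assms
proof (induction "size A" arbitrary: A B)
  case 0
  then show ?case
    by (intro exI[of _ "{#}"]) (auto simp: cyclic_forest_def)
next
  case (Suc m)
  have "A \<noteq> {#}" "B \<noteq> {#}"
    using Suc by auto
  then obtain i j where i: "i \<in># A" and j: "j \<in># B"
    and min: "\<And>i' j'. i' \<in># A \<Longrightarrow> j' \<in># B \<Longrightarrow> cyc_diff n j i \<le> cyc_diff n j' i'"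
    using obtain_shortest_arc[where n = n] by blast
  obtain A' B' where A': "A = add_mset i A'" and B': "B = add_mset j B'"
    using i j by (meson mset_add)
  obtain M where M: "cyclic_forest n I J (set_mset M)" "image_mset fst M = A'" "image_mset snd M = B'"
    using Suc.hyps(1)[of A' B'] Suc.hyps(2) Suc.prems by (auto simp: A' B')
  \<comment> \<open>In either order, each alternative of a crossing requires \<open>(i, j')\<close>
    or \<open>(i', j)\<close> to be strictly shorter than \<open>(i, j)\<close>.\<close>
  have noncross: "\<not> cyc_cross n (i, j) \<beta> \<and> \<not> cyc_cross n \<beta> (i, j)" if "\<beta> \<in># M" for \<beta>
  proof -
    obtain i' j' where \<beta>: "\<beta> = (i', j')"
      by fastforce
    have "i' \<in># A" "j' \<in># B"
      using imageI[OF that, of fst] imageI[OF that, of snd] by (auto simp: \<beta> A' B' simp flip: M(2,3))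
    then have "cyc_diff n j i \<le> cyc_diff n j i'" "cyc_diff n j i \<le> cyc_diff n j' i"
      using min i j by blast+
    then show ?thesis
      by (auto simp: \<beta>)
  qed
  have "(i, j) \<in> I \<times> J"
    using i j Suc.prems by auto
  then have "cyclic_forest n I J (set_mset (add_mset (i, j) M))"
    using M(1) noncross unfolding cyclic_forest_def by (auto simp del: cyc_cross.simps)
  then show ?case
    using M(2,3) by (intro exI[of _ "add_mset (i, j) M"]) (simp add: A' B')
qed

text \<open>The two projections give a bijection onto pairs of multisets of size \<open>m\<close>
  over \<open>I\<close> and over \<open>J\<close>, each counted by stars and bars.\<close>

lemma card_noncrossing_msets:
  assumes bounds: "I \<subseteq> {0..n}" "J \<subseteq> {0..n}" and "I \<noteq> {}" "J \<noteq> {}"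
  shows "card {M. cyclic_forest n I J (set_mset M) \<and> size M = m} =
    ((m + (card I - 1)) choose m) * ((m + (card J - 1)) choose m)"
proof -
  let ?S = "{M. cyclic_forest n I J (set_mset M) \<and> size M = m}"
  let ?g = "\<lambda>M. (image_mset fst M, image_mset snd M)"
  have fin: "finite I" "finite J"
    using bounds finite_subset by blast+
  then have pos: "card I > 0" "card J > 0"
    using assms by (auto simp: card_gt_0_iff)
  have "inj_on ?g ?S"
  proof (rule inj_onI)
    fix M N assume "M \<in> ?S" "N \<in> ?S" "?g M = ?g N"
    then show "M = N"
      using noncrossing_mset_unique[OF _ _ _ _ bounds, of M N] by simp
  qed
  moreover have "?g ` ?S = multisets_of_size I m \<times> multisets_of_size J m"
  proof (intro equalityI subsetI)
    fix x assume "x \<in> ?g ` ?S"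
    then obtain M where "x = ?g M" "set_mset M \<subseteq> I \<times> J" "size M = m"
      by (auto simp: cyclic_forest_def)
    then show "x \<in> multisets_of_size I m \<times> multisets_of_size J m"
      by (auto simp: multisets_of_size_def)
  next
    fix x assume "x \<in> multisets_of_size I m \<times> multisets_of_size J m"
    then obtain A B where x: "x = (A, B)" "set_mset A \<subseteq> I" "set_mset B \<subseteq> J" "size A = m" "size B = m"
      by (auto simp: multisets_of_size_def)
    then obtain M where M: "cyclic_forest n I J (set_mset M)" "image_mset fst M = A" "image_mset snd M = B"
      using noncrossing_mset_exists[of A B I J n] by metis
    have "size M = m"
      using \<open>size A = m\<close> size_image_mset[of fst M] by (simp only: M)
    with M show "x \<in> ?g ` ?S"
      unfolding x(1) by (intro image_eqI[of _ _ M]) simp_all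
  qed
  ultimately have "card ?S = card (multisets_of_size I m) * card (multisets_of_size J m)"
    by (simp only: card_cartesian_product flip: card_image)
  then show ?thesis
    using fin pos by (simp add: card_multisets_of_size add.commute)
qed

theorem theorem8p5:
  fixes n :: nat and I J :: "nat set"
  assumes "I \<subseteq> {0..n}" and "I \<noteq> {}"
    and "J \<subseteq> {0..n}" and "J \<noteq> {}"
  shows "\<forall>k. h_vector (cyclohedral_triangulation n I J) k =
           int (((card I - 1) choose k) * ((card J - 1) choose k))"
proof
  fix k
  let ?K = "cyclohedral_triangulation n I J"
  have "finite (I \<times> J)"
    using assms finite_subset by blast
  moreover have "?K \<subseteq> Pow (I \<times> J)"
    by (auto simp: cyclohedral_triangulation_def cyclic_forest_def)
  ultimately have fin: "finite ?K" "\<And>F. F \<in> ?K \<Longrightarrow> finite F"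
    by (auto intro: finite_subset)
  have "card {M. set_mset M \<in> ?K \<and> size M = m} =
      ((m + (card I - 1)) choose m) * ((m + (card J - 1)) choose m)" for m
    using card_noncrossing_msets assms by (simp add: cyclohedral_triangulation_def)
  note face = face_number_from_multiset_count[OF fin this]
  show "h_vector ?K k = int (((card I - 1) choose k) * ((card J - 1) choose k))"
    \<comment> \<open>Here \<open>d\<close> is \<open>card I - 1 + (card J - 1) + 1\<close>, the
      number of arcs in a largest forest. Beyond it both binomials vanish, and the entry at 0 is
      1.\<close>
    by (rule h_vector_eqI[OF fin(1) face]) auto
qed

end
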